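(* Let $P_{(2,1)}$ be the set of all cylindric partitions with profile $c=(2,1)$. Then, as formal power series in $q$, $$\sum_{\Lambda\in P_{(2,1)}} q^{|\Lambda|}=\left(\sum_{n\ge0}\frac{q^{n^2}}{(q^4;q^4)_n}\right)\frac{(-q^2;q^2)_\infty}{(q;q)_\infty}.$$
   Context: Let $r,\ell$ be positive integers and $c=(c_1,\dots,c_r)$ a composition of $\ell$ into $r$ nonnegative integer parts (zero entries allowed). A cylindric partition with profile $c$ is a tuple $\Lambda=(\lambda^{(1)},\dots,\lambda^{(r)})$ of ordinary partitions $\lambda^{(i)}=(\lambda^{(i)}_1\ge\lambda^{(i)}_2\ge\cdots)$ (parts beyond the length are taken to be $0$) such that for all $i,j$: $\lambda^{(i)}_j\ge\lambda^{(i+1)}_{j+c_{i+1}}$ for $1\le i\le r-1$, and $\lambda^{(r)}_j\ge\lambda^{(1)}_{j+c_1}$. The size $|\Lambda|$ is the sum of all parts of all $\lambda^{(i)}$; the empty cylindric partition is included with size $0$. Notation: $(a;q)_n=\prod_{k=1}^n(1-aq^{k-1})$, $(a;q)_\infty=\lim_{n\to\infty}(a;q)_n$. *)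

theory Defs
  imports "HOL-Analysis.Infinite_Sum" "HOL-Computational_Algebra.Formal_Power_Series"
begin

text \<open>
  A partition is represented by its weakly decreasing sequence of parts, padded with zeros.
  The sequence is indexed from 0, so \<open>l j\<close> is the part usually written \<open>\<lambda>\<^sub>j\<^sub>+\<^sub>1\<close>.
\<close>

definition is_partition :: "(nat \<Rightarrow> nat) \<Rightarrow> bool" where
  "is_partition l \<longleftrightarrow> antimono l \<and> finite {j. l j \<noteq> 0}"

definition partition_size :: "(nat \<Rightarrow> nat) \<Rightarrow> nat" where
  "partition_size l = (\<Sum>j | l j \<noteq> 0. l j)"

text \<open>
  Profiles and tuples of partitions are lists, so \<open>c ! i\<close> and \<open>L ! i\<close> are the entries usually
  written \<open>c\<^sub>i\<^sub>+\<^sub>1\<close> and \<open>\<lambda>\<^sup>(\<^sup>i\<^sup>+\<^sup>1\<^sup>)\<close>. Only nonempty profiles are meaningful.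
\<close>

definition cylindric_partitions :: "nat list \<Rightarrow> (nat \<Rightarrow> nat) list set" where
  "cylindric_partitions c = {L. length L = length c \<and> (\<forall>l\<in>set L. is_partition l) \<and>
     (\<forall>i j. Suc i < length c \<longrightarrow> (L ! i) j \<ge> (L ! Suc i) (j + c ! Suc i)) \<and>
     (\<forall>j. (L ! (length c - 1)) j \<ge> (L ! 0) (j + c ! 0))}"

definition cylindric_size :: "(nat \<Rightarrow> nat) list \<Rightarrow> nat" where
  "cylindric_size L = (\<Sum>l\<leftarrow>L. partition_size l)"

definition qpoch :: "'a::comm_ring_1 \<Rightarrow> 'a \<Rightarrow> nat \<Rightarrow> 'a" where
  "qpoch a q n = (\<Prod>k=1..n. 1 - a * q ^ (k - 1))"

text \<open>
  For formal power series, limits and infinite sums refer to the topology of the library's metric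
  on \<open>fps\<close>, in which convergence means that each coefficient is eventually constant.
\<close>

definition qpoch_inf :: "'a::{comm_ring_1, t2_space} \<Rightarrow> 'a \<Rightarrow> 'a" where
  "qpoch_inf a q = lim (\<lambda>n. qpoch a q n)"

end

theory Submission
  imports Defs
begin

text \<open>
  Interleave a cylindric partition of profile \<open>(2, 1)\<close> as \<open>p = (\<lambda>\<^sub>1, \<mu>\<^sub>1, \<lambda>\<^sub>2, \<mu>\<^sub>2, \<dots>)\<close>: the defining
  inequalities then say exactly that \<open>p i \<ge> p j\<close> whenever \<open>j \<ge> i + 2\<close>. Hence the set \<open>S\<close> of ascents of \<open>p\<close>
  has no two consecutive elements, and swapping \<open>p i\<close> with \<open>p (i + 1)\<close> for all \<open>i \<in> S\<close> sorts \<open>p\<close> into a partition that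
  descends strictly at every \<open>i \<in> S\<close>. Subtracting \<open>1\<close> from the first \<open>i + 1\<close> parts for each \<open>i \<in> S\<close>
  leaves an arbitrary partition, so the generating function is
  \<open>1 / (q; q)\<^sub>\<infinity>\<close> times that of the sets \<open>S\<close>, which is \<open>\<Sum>\<^sub>k q^(k\<^sup>2) / (q; q)\<^sub>k\<close>.

  This sum equals \<open>(-q\<^sup>2; q\<^sup>2)\<^sub>\<infinity> \<Sum>\<^sub>n q^(n\<^sup>2) / (q\<^sup>4; q\<^sup>4)\<^sub>n\<close>: expand
  \<open>(-q\<^sup>2; q\<^sup>2)\<^sub>\<infinity> / (-q\<^sup>2; q\<^sup>2)\<^sub>n\<close> by Euler's series and collect the terms with \<open>N = n + k\<close>, using
  \<open>\<Sum>\<^sub>k\<^sub>\<le>\<^sub>N q^k / ((q\<^sup>2; q\<^sup>2)\<^sub>k (q\<^sup>2; q\<^sup>2)\<^sub>N\<^sub>-\<^sub>k) = 1 / (q; q)\<^sub>N\<close>.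
\<close>

unbundle fps_syntax

section \<open>Series of formal power series\<close>

text \<open>
  Truncating at \<open>n \<le> m\<close> is harmless only if \<open>f n\<close> is divisible by \<open>X ^ n\<close>; otherwise the value is junk.
\<close>
definition fps_series :: "(nat \<Rightarrow> rat fps) \<Rightarrow> rat fps" where
  "fps_series f = Abs_fps (\<lambda>m. \<Sum>n\<le>m. f n $ m)"

text \<open>Terms with index above \<open>m\<close> vanish in degree \<open>m\<close>, so all
  coefficients up to \<open>N\<close> can share the cutoff \<open>N\<close>.\<close>

lemma fps_series_nth:
  assumes small: "\<And>n m. m < n \<Longrightarrow> f n $ m = 0" and "m \<le> N"
  shows "fps_series f $ m = (\<Sum>n\<le>N. f n $ m)"
  unfolding fps_series_def fps_nth_Abs_fps
  using \<open>m \<le> N\<close> by (intro sum.mono_neutral_left) (auto intro!: small)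

lemma sums_fps_series:
  assumes small: "\<And>n m. m < n \<Longrightarrow> f n $ m = 0"
  shows "f sums fps_series f"
  unfolding sums_def_le
proof (rule tendsto_fpsI)
  fix m
  show "eventually (\<lambda>N. (\<Sum>n\<le>N. f n) $ m = fps_series f $ m) sequentially"
    using eventually_ge_at_top[of m] 
    by eventually_elim (simp add: fps_sum_nth fps_series_nth[OF small])
qed

lemma fps_series_mult_right:
  assumes small: "\<And>n m. m < n \<Longrightarrow> f n $ m = 0"
  shows "fps_series f * g = fps_series (\<lambda>n. f n * g)"
proof (rule fps_ext)
  fix m
  have "(fps_series f * g) $ m = (\<Sum>i\<le>m. (\<Sum>n\<le>m. f n $ i) * g $ (m - i))"
    unfolding fps_mult_nth atLeast0AtMost by (intro sum.cong refl) (simp add: fps_series_nth[OF small])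
  also have "\<dots> = (\<Sum>n\<le>m. \<Sum>i\<le>m. f n $ i * g $ (m - i))"
    by (simp add: sum_distrib_right) (rule sum.swap)
  finally show "(fps_series f * g) $ m = fps_series (\<lambda>n. f n * g) $ m"
    by (simp add: fps_series_def fps_mult_nth atLeast0AtMost)
qed

lemma fps_series_mult_left:
  assumes small: "\<And>n m. m < n \<Longrightarrow> f n $ m = 0"
  shows "g * fps_series f = fps_series (\<lambda>n. g * f n)"
  using fps_series_mult_right[of f g, OF small] by (simp add: mult.commute)

lemma fps_series_diff: "fps_series f - fps_series g = fps_series (\<lambda>n. f n - g n)"
  by (rule fps_ext) (simp add: fps_series_def sum_subtractf)

lemma fps_series_Suc:
  assumes small: "\<And>n m. m < n \<Longrightarrow> f n $ m = 0" and "f 0 = 0"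
  shows "fps_series f = fps_series (\<lambda>n. f (Suc n))"
proof (rule fps_ext)
  fix m
  have "fps_series f $ m = (\<Sum>n\<le>Suc m. f n $ m)"
    by (rule fps_series_nth[OF small]) simp_all
  also have "\<dots> = (\<Sum>n\<le>m. f (Suc n) $ m)"
    using assms by (simp only: sum.atMost_Suc_shift) simp
  finally show "fps_series f $ m = fps_series (\<lambda>n. f (Suc n)) $ m"
    by (simp add: fps_series_def)
qed

text \<open>Only the finitely many pairs with n + k at most m reach degree \<open>m\<close>, so the
  rearrangement by diagonals is a finite one in each degree.\<close>

lemma fps_series_double:
  assumes small: "\<And>n k m. m < n + k \<Longrightarrow> f n k $ m = 0"
  shows "fps_series (\<lambda>n. fps_series (f n)) = fps_series (\<lambda>N. \<Sum>k\<le>N. f k (N - k))"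
proof (rule fps_ext)
  fix m
  have "fps_series (\<lambda>n. fps_series (f n)) $ m = (\<Sum>n\<le>m. \<Sum>k\<le>m. f n k $ m)"
    by (simp add: fps_series_def)
  also have "\<dots> = (\<Sum>n\<le>m. \<Sum>k\<le>m - n. f n k $ m)"
    by (intro sum.cong refl sum.mono_neutral_right) (auto intro!: small)
  also have "\<dots> = (\<Sum>(n, k)\<in>Sigma {..m} (\<lambda>n. {..m - n}). f n k $ m)"
    by (simp add: sum.Sigma)
  also have "Sigma {..m} (\<lambda>n. {..m - n}) = {(n, k). n + k \<le> m}"
    by auto
  also have "(\<Sum>(n, k)\<in>{(n, k). n + k \<le> m}. f n k $ m) = (\<Sum>N\<le>m. \<Sum>k\<le>N. f k (N - k) $ m)"
    by (rule sum.triangle_reindex_eq)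
  finally show "fps_series (\<lambda>n. fps_series (f n)) $ m = fps_series (\<lambda>N. \<Sum>k\<le>N. f k (N - k)) $ m"
    by (simp add: fps_series_def fps_sum_nth)
qed

lemma fps_mult_cong_nth:
  fixes f g h :: "rat fps"
  assumes "\<And>i. i \<le> m \<Longrightarrow> f $ i = g $ i"
  shows "(f * h) $ m = (g * h) $ m"
  unfolding fps_mult_nth using assms by (intro sum.cong) auto

section \<open>The q-series identity\<close>

lemma qpoch_0 [simp]: "qpoch a q 0 = 1"
  by (simp add: qpoch_def)

lemma qpoch_Suc: "qpoch a q (Suc n) = qpoch a q n * (1 - a * q ^ n)"
  by (simp add: qpoch_def)

lemma qpoch_nth_0:
  fixes a q :: "rat fps"
  assumes "a $ 0 = 0"
  shows "qpoch a q n $ 0 = 1"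
  using assms by (induction n) (simp_all add: qpoch_Suc)

text \<open>Multiplying by 1 - a q^n only affects degrees n and above, because \<open>q\<close> has
  zero constant term. Hence coefficient \<open>m\<close> is frozen from m + 1 factors
  onwards.\<close>

lemma qpoch_inf_nth:
  fixes a q :: "rat fps"
  assumes q: "q $ 0 = 0" and "m < n"
  shows "qpoch_inf a q $ m = qpoch a q n $ m"
proof -
  have stable: "qpoch a q n $ m = qpoch a q (Suc m) $ m" if "Suc m \<le> n" for n m
    using that
  proof (induction n rule: dec_induct)
    case (step n)
    have "qpoch a q (Suc n) = qpoch a q n - (qpoch a q n * a) * q ^ n"
      by (simp add: qpoch_Suc algebra_simps)
    moreover have "((qpoch a q n * a) * q ^ n) $ m = 0"
      unfolding fps_mult_nth
      using step(1) by (intro sum.neutral ballI) (simp add: startsby_zero_power_prefix[OF q])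
    ultimately show ?case using step.IH by simp
  qed simp
  have "(\<lambda>n. qpoch a q n) \<longlonglongrightarrow> Abs_fps (\<lambda>m. qpoch a q (Suc m) $ m)"
  proof (rule tendsto_fpsI)
    fix m
    show "eventually (\<lambda>n. qpoch a q n $ m = Abs_fps (\<lambda>m. qpoch a q (Suc m) $ m) $ m) sequentially"
      using eventually_ge_at_top[of "Suc m"] by eventually_elim (auto intro: stable)
  qed
  hence "qpoch_inf a q = Abs_fps (\<lambda>m. qpoch a q (Suc m) $ m)"
    by (simp add: qpoch_inf_def limI)
  thus ?thesis
    using stable[of m n] \<open>m < n\<close> by simp
qed

abbreviation "X \<equiv> (fps_X :: rat fps)"

lemma inverse_qpoch_Suc:
  fixes a q :: "rat fps"
  assumes "a $ 0 = 0"
  shows "(1 - a * q ^ n) * inverse (qpoch a q (Suc n)) = inverse (qpoch a q n)"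
proof -
  have "(1 - a * q ^ n) $ 0 \<noteq> 0"
    using assms by simp
  from inverse_mult_eq_1[OF this] show ?thesis
    unfolding qpoch_Suc fps_inverse_mult by (metis mult.commute mult.left_commute mult_1_right)
qed

text \<open>Permits cancelling this factor in each recurrence that determines a generating function
  below.\<close>

lemma one_minus_X_power_neq_0: "1 - X ^ Suc n \<noteq> 0"
proof
  assume "1 - X ^ Suc n = 0"
  hence "(1 - X ^ Suc n) $ 0 = 0"
    by (simp only: fps_zero_nth)
  thus False by simp
qed

lemma inverse_qpoch_X2_Suc:
  "(1 - X ^ (2 * Suc k)) * inverse (qpoch (X\<^sup>2) (X\<^sup>2) (Suc k)) = inverse (qpoch (X\<^sup>2) (X\<^sup>2) k)"
proof -
  have "(X\<^sup>2) $ 0 = 0"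
    by simp
  from inverse_qpoch_Suc[OF this, where n = k and q = "X\<^sup>2"] show ?thesis
    by (simp only: power_mult power_Suc)
qed

text \<open>
  In terms of the generating function \<open>E(t) = \<Sum>\<^sub>i t^i / (q\<^sup>2; q\<^sup>2)\<^sub>i\<close>, which satisfies
  \<open>E(t) - E(q\<^sup>2 t) = t E(t)\<close>, this says that \<open>E(q t) E(t) = \<Sum>\<^sub>N t^N / (q; q)\<^sub>N\<close>.
\<close>
lemma sum_inverse_qpoch_convolution:
  "(\<Sum>k\<le>N. X ^ k * inverse (qpoch (X\<^sup>2) (X\<^sup>2) k) * inverse (qpoch (X\<^sup>2) (X\<^sup>2) (N - k)))
     = inverse (qpoch X X N)"
proof (induction N)
  case (Suc N)
  define e where "e k = inverse (qpoch (X\<^sup>2) (X\<^sup>2) k)" for k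
  define a where "a N = (\<Sum>k\<le>N. X ^ k * e k * e (N - k))" for N
  have e_Suc: "(1 - X ^ (2 * Suc k)) * e (Suc k) = e k" for k
    unfolding e_def by (rule inverse_qpoch_X2_Suc)
  \<comment> \<open>This is the coefficient of t^(N+1) in E(q^2 t) E(q t). Subtracting it from that
    of E(q t) E(t) leaves E(q t) (E(t) - E(q^2 t)) = t E(q t) E(t), whose coefficient is
    \<open>a N\<close>.\<close>
  have "X ^ Suc N * a (Suc N) = (\<Sum>k\<le>Suc N. X ^ Suc N * (X ^ (Suc N - k) * e (Suc N - k) * e k))"
    unfolding a_def sum_distrib_left
    by (rule sum.reindex_bij_witness[of _ "\<lambda>k. Suc N - k" "\<lambda>k. Suc N - k"]) auto
  also have "\<dots> = (\<Sum>k\<le>Suc N. X ^ k * e k * (X ^ (2 * (Suc N - k)) * e (Suc N - k)))"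
  proof (rule sum.cong)
    fix k assume "k \<in> {..Suc N}"
    then obtain d where d: "Suc N = k + d"
      using le_Suc_ex by auto
    show "X ^ Suc N * (X ^ (Suc N - k) * e (Suc N - k) * e k) =
        X ^ k * e k * (X ^ (2 * (Suc N - k)) * e (Suc N - k))"
      unfolding d by (simp add: power_add mult_2 mult_2_right mult_ac)
  qed simp
  finally have "(1 - X ^ Suc N) * a (Suc N)
      = (\<Sum>k\<le>Suc N. X ^ k * e k * ((1 - X ^ (2 * (Suc N - k))) * e (Suc N - k)))"
    unfolding left_diff_distrib a_def by (simp only: sum_subtractf right_diff_distrib mult_1 mult.assoc)
  \<comment> \<open>The term k = N + 1 drops out, its factor being 1 - q^0 = 0.\<close>
  also have "\<dots> = (\<Sum>k\<le>N. X ^ k * e k * ((1 - X ^ (2 * Suc (N - k))) * e (Suc (N - k))))"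
    by (simp add: Suc_diff_le)
  also have "\<dots> = a N"
    unfolding a_def e_Suc ..
  also have "\<dots> = inverse (qpoch X X N)"
    using Suc.IH by (simp add: a_def e_def)
  also have "\<dots> = (1 - X ^ Suc N) * inverse (qpoch X X (Suc N))"
    using inverse_qpoch_Suc[of X X N] by simp
  finally have "(1 - X ^ Suc N) * a (Suc N) = (1 - X ^ Suc N) * inverse (qpoch X X (Suc N))" .
  hence "a (Suc N) = inverse (qpoch X X (Suc N))"
    by (simp only: mult_left_cancel[OF one_minus_X_power_neq_0])
  thus ?case
    by (simp add: a_def e_def)
qed simp

section \<open>Euler's expansion of the infinite product\<close>

lemma fps_X_power_mult_small:
  assumes "m < n" "n \<le> k"
  shows "(X ^ k * f) $ m = 0"
  using assms by (simp add: fps_X_power_mult_nth)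

text \<open>Euler's series for \<open>(-q\<^bsup>2n+2\<^esup>; q\<^sup>2)\<^sub>\<infinity>\<close>.\<close>
definition euler_tail :: "nat \<Rightarrow> rat fps" where
  "euler_tail n = fps_series (\<lambda>k. X ^ (k\<^sup>2 + k + 2 * n * k) * inverse (qpoch (X\<^sup>2) (X\<^sup>2) k))"

text \<open>Splits off the first factor of the product. On the series side, the difference of the
  two tails puts 1 - q^(2k) into the k-th term, which cancels the last factor of its denominator;
  shifting the index then gives q^(2n+2) times the later tail.\<close>

lemma euler_tail_step: "euler_tail n = (1 + X ^ (2 * Suc n)) * euler_tail (Suc n)"
proof -
  define e where "e k = inverse (qpoch (X\<^sup>2) (X\<^sup>2) k)" for k
  have e_Suc: "(1 - X ^ (2 * Suc k)) * e (Suc k) = e k" for k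
    unfolding e_def by (rule inverse_qpoch_X2_Suc)
  have "euler_tail n - euler_tail (Suc n) =
      fps_series (\<lambda>k. X ^ (k\<^sup>2 + k + 2 * n * k) * ((1 - X ^ (2 * k)) * e k))"
  proof -
    have "k\<^sup>2 + k + 2 * Suc n * k = (k\<^sup>2 + k + 2 * n * k) + 2 * k" for k
      by simp
    thus ?thesis
      unfolding euler_tail_def fps_series_diff e_def
      by (simp only: power_add[of X _ "2 * _"] left_diff_distrib right_diff_distrib mult_1 mult.assoc)
  qed
  also have "\<dots> = fps_series (\<lambda>k. X ^ ((Suc k)\<^sup>2 + Suc k + 2 * n * Suc k) * e k)"
    by (subst fps_series_Suc) (auto intro!: fps_X_power_mult_small simp only: e_Suc, simp_all)
  also have "\<dots> = fps_series (\<lambda>k. X ^ (2 * Suc n) * (X ^ (k\<^sup>2 + k + 2 * Suc n * k) * e k))"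
  proof -
    have "(Suc k)\<^sup>2 + Suc k + 2 * n * Suc k = 2 * Suc n + (k\<^sup>2 + k + 2 * Suc n * k)" for k
      by (simp add: power2_eq_square algebra_simps)
    thus ?thesis by (simp only: power_add[of X "2 * Suc n"] mult.assoc)
  qed
  also have "\<dots> = X ^ (2 * Suc n) * euler_tail (Suc n)"
    unfolding euler_tail_def e_def
    by (rule fps_series_mult_left[symmetric]) (auto intro!: fps_X_power_mult_small)
  finally show ?thesis
    by (simp add: algebra_simps)
qed

lemma euler_tail_0: "euler_tail 0 = qpoch (- (X\<^sup>2)) (X\<^sup>2) n * euler_tail n"
proof (induction n)
  case (Suc n)
  have "X\<^sup>2 * (X\<^sup>2) ^ n = X ^ (2 * Suc n)"
    by (simp only: power_mult power_Suc)
  thus ?case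
    unfolding Suc.IH euler_tail_step[of n] qpoch_Suc by (simp add: algebra_simps)
qed simp

text \<open>After m + 1 factors are split off, every term k > 0 of the remaining tail has degree
  above m, so the tail agrees with 1 up to degree m.\<close>

lemma qpoch_inf_eq_euler_tail: "qpoch_inf (- (X\<^sup>2)) (X\<^sup>2) = euler_tail 0"
proof (rule fps_ext)
  fix m
  have tail: "euler_tail (Suc m) $ i = 1 $ i" if "i \<le> m" for i
  proof -
    have "(X ^ (k\<^sup>2 + k + 2 * Suc m * k) * inverse (qpoch (X\<^sup>2) (X\<^sup>2) k)) $ i
        = (if k = 0 then 1 $ i else 0)" for k
    proof (cases k)
      case (Suc j)
      have "Suc m \<le> k\<^sup>2 + k + 2 * Suc m * k"
        by (simp add: Suc)
      thus ?thesis
        using that Suc by (intro trans[OF fps_X_power_mult_small[of _ "Suc m"]]) auto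
    qed simp
    thus ?thesis
      by (simp add: euler_tail_def fps_series_def)
  qed
  have "euler_tail 0 $ m = (euler_tail (Suc m) * qpoch (- (X\<^sup>2)) (X\<^sup>2) (Suc m)) $ m"
    by (metis euler_tail_0 mult.commute)
  also have "\<dots> = (1 * qpoch (- (X\<^sup>2)) (X\<^sup>2) (Suc m)) $ m"
    by (intro fps_mult_cong_nth tail)
  also have "\<dots> = qpoch_inf (- (X\<^sup>2)) (X\<^sup>2) $ m"
    by (simp add: qpoch_inf_nth[of _ m "Suc m"])
  finally show "qpoch_inf (- (X\<^sup>2)) (X\<^sup>2) $ m = euler_tail 0 $ m" ..
qed

lemma qpoch_minus_mult: "qpoch a q n * qpoch (- a) q n = qpoch (a\<^sup>2) (q\<^sup>2) n"
proof (induction n)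
  case (Suc n)
  have factor: "1 - a\<^sup>2 * (q\<^sup>2) ^ n = (1 - a * q ^ n) * (1 - - a * q ^ n)"
    by (simp add: algebra_simps power2_eq_square power_mult_distrib)
  show ?case
    unfolding qpoch_Suc Suc.IH[symmetric] by (simp only: factor mult_ac)
qed simp

text \<open>The exponents combine to n^2 + k^2 + k + 2nk = (n + k)^2 + k. On a diagonal n + k = N
  the square is constant, and only the linear exponent is left inside the convolution.\<close>

lemma rogers_series_mult_qpoch_inf:
  "fps_series (\<lambda>n. X ^ n\<^sup>2 * inverse (qpoch (X ^ 4) (X ^ 4) n)) * qpoch_inf (- (X\<^sup>2)) (X\<^sup>2)
     = fps_series (\<lambda>n. X ^ n\<^sup>2 * inverse (qpoch X X n))"
proof -
  define e where "e k = inverse (qpoch (X\<^sup>2) (X\<^sup>2) k)" for k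
  have le_sq: "n \<le> n\<^sup>2" for n :: nat
    by (simp add: power2_eq_square)
  have four: "qpoch (X ^ 4) (X ^ 4) n = qpoch (X\<^sup>2) (X\<^sup>2) n * qpoch (- (X\<^sup>2)) (X\<^sup>2) n" for n
    by (simp add: qpoch_minus_mult flip: power_mult)
  have summand: "X ^ n\<^sup>2 * inverse (qpoch (X ^ 4) (X ^ 4) n) * euler_tail 0
      = fps_series (\<lambda>k. X ^ ((n + k)\<^sup>2 + k) * (e n * e k))" for n
  proof -
    have "inverse (qpoch (- (X\<^sup>2)) (X\<^sup>2) n) * qpoch (- (X\<^sup>2)) (X\<^sup>2) n = 1"
      by (intro inverse_mult_eq_1) (simp add: qpoch_nth_0)
    hence "X ^ n\<^sup>2 * inverse (qpoch (X ^ 4) (X ^ 4) n) * euler_tail 0 = (X ^ n\<^sup>2 * e n) * euler_tail n"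
      unfolding euler_tail_0[of n] four fps_inverse_mult e_def
      by (simp add: mult.assoc)
    also have "\<dots> = fps_series (\<lambda>k. (X ^ n\<^sup>2 * e n) * (X ^ (k\<^sup>2 + k + 2 * n * k) * e k))"
      unfolding euler_tail_def e_def
      by (rule fps_series_mult_left) (auto intro!: fps_X_power_mult_small)
    also have "\<dots> = fps_series (\<lambda>k. X ^ ((n + k)\<^sup>2 + k) * (e n * e k))"
    proof -
      have "(n + k)\<^sup>2 + k = n\<^sup>2 + (k\<^sup>2 + k + 2 * n * k)" for k
        by (simp add: power2_sum)
      thus ?thesis by (simp only: power_add[of X "n\<^sup>2"] mult_ac)
    qed
    finally show ?thesis .
  qed
  have "fps_series (\<lambda>n. X ^ n\<^sup>2 * inverse (qpoch (X ^ 4) (X ^ 4) n)) * qpoch_inf (- (X\<^sup>2)) (X\<^sup>2)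
      = fps_series (\<lambda>n. fps_series (\<lambda>k. X ^ ((n + k)\<^sup>2 + k) * (e n * e k)))"
    unfolding qpoch_inf_eq_euler_tail summand[symmetric]
    by (rule fps_series_mult_right) (auto intro!: fps_X_power_mult_small le_sq)
  also have "\<dots> = fps_series (\<lambda>N. \<Sum>k\<le>N. X ^ ((k + (N - k))\<^sup>2 + (N - k)) * (e k * e (N - k)))"
    by (rule fps_series_double) (auto intro!: fps_X_power_mult_small trans_le_add1 le_sq)
  also have "\<dots> = fps_series (\<lambda>n. X ^ n\<^sup>2 * inverse (qpoch X X n))"
  proof (rule arg_cong[where f = fps_series], rule ext)
    fix N
    \<comment> \<open>Reflecting k to N - k brings the linear exponent into the form required by
      \<open>sum_inverse_qpoch_convolution\<close>.\<close>
    have "(\<Sum>k\<le>N. X ^ ((k + (N - k))\<^sup>2 + (N - k)) * (e k * e (N - k)))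
        = (\<Sum>k\<le>N. X ^ N\<^sup>2 * (X ^ k * e k * e (N - k)))"
      by (rule sum.reindex_bij_witness[of _ "\<lambda>k. N - k" "\<lambda>k. N - k"])
         (auto simp: power_add mult_ac simp del: Nat.add_diff_assoc)
    thus "(\<Sum>k\<le>N. X ^ ((k + (N - k))\<^sup>2 + (N - k)) * (e k * e (N - k)))
        = X ^ N\<^sup>2 * inverse (qpoch X X N)"
      by (simp add: sum_inverse_qpoch_convolution e_def flip: sum_distrib_left)
  qed
  finally show ?thesis .
qed

section \<open>Generating functions of weighted sets\<close>

text \<open>
  An infinite fibre of \<open>w\<close> would contribute \<open>0\<close>, hence the companion predicate \<open>finite_weights\<close>.
\<close>
definition wgf :: "('a \<Rightarrow> nat) \<Rightarrow> 'a set \<Rightarrow> rat fps" where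
  "wgf w A = Abs_fps (\<lambda>n. of_nat (card {x\<in>A. w x = n}))"

definition finite_weights :: "('a \<Rightarrow> nat) \<Rightarrow> 'a set \<Rightarrow> bool" where
  "finite_weights w A \<longleftrightarrow> (\<forall>n. finite {x\<in>A. w x = n})"

lemma wgf_nth: "wgf w A $ n = of_nat (card {x\<in>A. w x = n})"
  by (simp add: wgf_def)

lemma finite_weightsD: "finite_weights w A \<Longrightarrow> finite {x\<in>A. w x = n}"
  by (simp add: finite_weights_def)

lemma finite_weights_subset: "finite_weights w B \<Longrightarrow> A \<subseteq> B \<Longrightarrow> finite_weights w A"
  unfolding finite_weights_def by (auto intro: finite_subset[rotated])

text \<open>Passage from counting to the topological sum: in degree n each object of weight n
  contributes 1, all others 0.\<close>

lemma has_sum_wgf: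
  assumes "finite_weights w A"
  shows "((\<lambda>x. X ^ w x) has_sum wgf w A) A"
proof (rule has_sum_fpsI)
  fix n
  have eq: "{x \<in> A. (X ^ w x) $ n \<noteq> 0} = {x \<in> A. w x = n}"
    by auto
  show "finite {x \<in> A. (X ^ w x) $ n \<noteq> 0}"
    using assms by (simp only: eq finite_weightsD)
  have "(\<Sum>x | x \<in> A \<and> (X ^ w x) $ n \<noteq> 0. (X ^ w x) $ n) = (\<Sum>x\<in>{x \<in> A. w x = n}. 1)"
    unfolding eq by (intro sum.cong) auto
  thus "wgf w A $ n = (\<Sum>x | x \<in> A \<and> (X ^ w x) $ n \<noteq> 0. (X ^ w x) $ n)"
    by (simp add: wgf_nth)
qed

lemma
  assumes "bij_betw f A B" and "\<And>x. x \<in> A \<Longrightarrow> w' (f x) = w x + k"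
  shows wgf_bij_betw_shift: "wgf w' B = X ^ k * wgf w A"
    and finite_weights_bij_betw: "finite_weights w A \<Longrightarrow> finite_weights w' B"
proof -
  have bij: "bij_betw f {x\<in>A. w x + k = n} {y\<in>B. w' y = n}" for n
    using assms by (auto simp: bij_betw_def inj_on_def image_iff)
  show "wgf w' B = X ^ k * wgf w A"
  proof (rule fps_ext)
    fix n
    \<comment> \<open>The case n < k is separate because truncated subtraction would turn n - k into
      0 there.\<close>
    have "{x\<in>A. w x + k = n} = (if n < k then {} else {x\<in>A. w x = n - k})"
      by auto
    thus "wgf w' B $ n = (X ^ k * wgf w A) $ n"
      using bij_betw_same_card[OF bij, of n]
      by (cases "n < k") (simp_all add: wgf_nth fps_X_power_mult_nth)
  qed
  show "finite_weights w' B" if "finite_weights w A"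
    unfolding finite_weights_def
  proof
    fix n
    have "finite {x\<in>A. w x + k = n}"
      using finite_weightsD[OF that, of "n - k"] by (rule finite_subset[rotated]) auto
    thus "finite {y\<in>B. w' y = n}"
      using bij_betw_finite[OF bij] by blast
  qed
qed

lemma wgf_Un_disjoint:
  assumes "finite_weights w (A \<union> B)" "A \<inter> B = {}"
  shows "wgf w (A \<union> B) = wgf w A + wgf w B"
proof (rule fps_ext)
  fix n
  have "finite {x\<in>A. w x = n}" "finite {x\<in>B. w x = n}"
    using finite_weightsD[OF assms(1), of n] by (auto elim: finite_subset[rotated])
  hence "card ({x\<in>A. w x = n} \<union> {x\<in>B. w x = n}) = card {x\<in>A. w x = n} + card {x\<in>B. w x = n}"
    using assms(2) by (intro card_Un_disjoint) auto
  moreover have "{x\<in>A \<union> B. w x = n} = {x\<in>A. w x = n} \<union> {x\<in>B. w x = n}"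
    by auto
  ultimately show "wgf w (A \<union> B) $ n = (wgf w A + wgf w B) $ n"
    by (simp add: wgf_nth)
qed

lemma
  assumes A: "finite_weights w A" and B: "finite_weights w' B"
  shows wgf_Times: "wgf (\<lambda>(x, y). w x + w' y) (A \<times> B) = wgf w A * wgf w' B"
    and finite_weights_Times: "finite_weights (\<lambda>(x, y). w x + w' y) (A \<times> B)"
proof -
  \<comment> \<open>Slicing a fibre by the weight of the first component produces the Cauchy
    product.\<close>
  define C where "C n i = {x\<in>A. w x = i} \<times> {y\<in>B. w' y = n - i}" for n i
  have eq: "{p \<in> A \<times> B. (\<lambda>(x, y). w x + w' y) p = n} = (\<Union>i\<in>{0..n}. C n i)" for n
    by (auto simp: C_def)
  have fin: "finite (C n i)" for n i
    unfolding C_def by (intro finite_cartesian_product finite_weightsD A B)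
  show "finite_weights (\<lambda>(x, y). w x + w' y) (A \<times> B)"
    unfolding finite_weights_def eq using fin by blast
  show "wgf (\<lambda>(x, y). w x + w' y) (A \<times> B) = wgf w A * wgf w' B"
  proof (rule fps_ext)
    fix n
    have "card (\<Union>i\<in>{0..n}. C n i) = (\<Sum>i=0..n. card (C n i))"
      by (intro card_UN_disjoint) (auto simp: fin, auto simp: C_def)
    thus "wgf (\<lambda>(x, y). w x + w' y) (A \<times> B) $ n = (wgf w A * wgf w' B) $ n"
      unfolding wgf_nth eq fps_mult_nth by (simp add: C_def card_cartesian_product)
  qed
qed

section \<open>Partitions\<close>

lemma partition_size_eq_sum:
  assumes "\<And>i. i \<ge> N \<Longrightarrow> f i = 0"
  shows "partition_size f = (\<Sum>i<N. f i)"
proof -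
  have "{j. f j \<noteq> 0} \<subseteq> {..<N}"
    by (rule subsetI, rule ccontr) (simp add: assms)
  thus ?thesis
    unfolding partition_size_def by (intro sum.mono_neutral_left) auto
qed

lemma finite_support_iff:
  fixes f :: "nat \<Rightarrow> nat"
  shows "finite {j. f j \<noteq> 0} \<longleftrightarrow> (\<exists>N. \<forall>i\<ge>N. f i = 0)"
proof
  assume "finite {j. f j \<noteq> 0}"
  then obtain N where N: "\<forall>j\<in>{j. f j \<noteq> 0}. j < N"
    using finite_nat_set_iff_bounded by blast
  have "f i = 0" if "i \<ge> N" for i
    using N that by (metis (mono_tags) mem_Collect_eq not_le)
  thus "\<exists>N. \<forall>i\<ge>N. f i = 0" by blast
next
  assume "\<exists>N. \<forall>i\<ge>N. f i = 0"
  then obtain N where N: "\<forall>i\<ge>N. f i = 0" ..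
  have "{j. f j \<noteq> 0} \<subseteq> {..<N}"
    by (rule subsetI, rule ccontr) (simp add: N)
  thus "finite {j. f j \<noteq> 0}"
    using finite_subset by blast
qed

definition partitions :: "(nat \<Rightarrow> nat) set" where
  "partitions = {l. is_partition l}"

definition partitions_length_le :: "nat \<Rightarrow> (nat \<Rightarrow> nat) set" where
  "partitions_length_le k = {l. antimono l \<and> (\<forall>i\<ge>k. l i = 0)}"

lemma partitions_length_le_subset: "partitions_length_le k \<subseteq> partitions"
  unfolding partitions_length_le_def partitions_def is_partition_def finite_support_iff by blast

text \<open>A nonzero part at index i forces the parts at 0, ..., i to be at least 1, so the size
  exceeds i.\<close>

lemma partition_length_le_size:
  assumes "l \<in> partitions"
  shows "l \<in> partitions_length_le (partition_size l)"
proof -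
  have anti: "antimono l" and fin: "finite {j. l j \<noteq> 0}"
    using assms by (auto simp: partitions_def is_partition_def)
  obtain N where N: "\<forall>i\<ge>N. l i = 0"
    using fin finite_support_iff by blast
  have bound: "i < partition_size l" if "l i \<noteq> 0" for i
  proof -
    have "Suc i = (\<Sum>j<Suc i. 1)" by simp
    also have "\<dots> \<le> (\<Sum>j<Suc i. l j)"
    proof (rule sum_mono)
      fix j assume "j \<in> {..<Suc i}"
      hence "l i \<le> l j" using anti by (auto simp: antimono_def)
      thus "1 \<le> l j" using that by simp
    qed
    also have "\<dots> \<le> (\<Sum>j<max N (Suc i). l j)"
      by (rule sum_mono2) auto
    also have "\<dots> = partition_size l"
      using N by (intro partition_size_eq_sum[symmetric]) simp
    finally show ?thesis by simp
  qed
  have "l i = 0" if "i \<ge> partition_size l" for i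
    by (rule ccontr) (use bound[of i] that in simp)
  thus ?thesis
    using anti by (simp add: partitions_length_le_def)
qed

lemma part_le_partition_size: "finite {j. l j \<noteq> 0} \<Longrightarrow> l i \<le> partition_size l"
  unfolding partition_size_def by (cases "l i = 0") (auto intro: member_le_sum)

text \<open>The size n bounds both the number of parts and each part, which leaves finitely many
  functions that are 0 outside \<open>{..<n}\<close>.\<close>

lemma finite_weights_partitions: "finite_weights partition_size partitions"
  unfolding finite_weights_def
proof
  fix n
  have "{l \<in> partitions. partition_size l = n} \<subseteq> {l. \<forall>i. (i \<in> {..<n} \<longrightarrow> l i \<in> {..n}) \<and> (i \<notin> {..<n} \<longrightarrow> l i = 0)}"
  proof (rule subsetI, unfold mem_Collect_eq, intro allI conjI impI)
    fix l i assume l: "l \<in> partitions \<and> partition_size l = n"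
    have "finite {j. l j \<noteq> 0}"
      using l by (simp add: partitions_def is_partition_def)
    from part_le_partition_size[OF this, of i] show "l i \<in> {..n}"
      using l by simp
    show "l i = 0" if "i \<notin> {..<n}"
      using partition_length_le_size[of l] l that by (auto simp: partitions_length_le_def)
  qed
  thus "finite {l \<in> partitions. partition_size l = n}"
    by (rule finite_subset) (intro finite_set_of_finite_funs finite_lessThan finite_atMost)
qed

text \<open>A partition with at most k + 1 parts either has at most k, or has exactly k + 1 and
  arises by adding 1 to each of the first k + 1 entries. So the series P satisfy P(k+1) = P(k) +
  q^(k+1) P(k+1).\<close>

lemma wgf_partitions_length_le: "wgf partition_size (partitions_length_le k) = inverse (qpoch X X k)"
proof (induction k)
  case 0
  have "partitions_length_le 0 = {\<lambda>_. 0}"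
    by (auto simp: partitions_length_le_def antimono_def)
  hence "wgf partition_size (partitions_length_le 0) $ n = 1 $ n" for n
    by (auto simp: wgf_nth partition_size_def Collect_conv_if)
  thus ?case
    by (simp add: fps_eq_iff)
next
  case (Suc k)
  define A where "A = {l \<in> partitions_length_le (Suc k). l k > 0}"
  define f where "f l i = (if i \<le> k then l i + 1 else 0)" for l :: "nat \<Rightarrow> nat" and i
  let ?P = "partitions_length_le"
  have iff: "l \<in> ?P k \<longleftrightarrow> l \<in> ?P (Suc k) \<and> l k = 0" for l
  proof
    assume l: "l \<in> ?P (Suc k) \<and> l k = 0"
    have "l i = 0" if "i \<ge> k" for i
      using l that by (cases "i = k") (auto simp: partitions_length_le_def)
    thus "l \<in> ?P k"
      using l by (simp add: partitions_length_le_def)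
  qed (simp add: partitions_length_le_def)
  have split: "?P (Suc k) = ?P k \<union> A"
    by (rule set_eqI) (auto simp only: A_def iff Un_iff mem_Collect_eq)
  have disjoint: "?P k \<inter> A = {}"
    by (auto simp only: A_def iff)
  have "bij_betw f (?P (Suc k)) A"
  proof (rule bij_betwI[where g = "\<lambda>l i. l i - 1"])
    show "f \<in> ?P (Suc k) \<rightarrow> A"
      by (auto simp: A_def partitions_length_le_def f_def antimono_def)
    \<comment> \<open>Truncated subtraction keeps the padding zeros at 0.\<close>
    show "(\<lambda>l i. l i - 1) \<in> A \<rightarrow> ?P (Suc k)"
      by (auto simp: A_def partitions_length_le_def antimono_def intro: diff_le_mono)
    show "(\<lambda>i. f l i - 1) = l" if "l \<in> ?P (Suc k)" for l
      using that by (auto simp: partitions_length_le_def f_def)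
    show "f (\<lambda>i. l i - 1) = l" if "l \<in> A" for l
    proof
      fix i
      show "f (\<lambda>i. l i - 1) i = l i"
      proof (cases "i \<le> k")
        case True
        hence "l k \<le> l i"
          using that by (auto simp: A_def partitions_length_le_def antimono_def)
        thus ?thesis
          using that True by (simp add: A_def f_def)
      qed (use that in \<open>simp add: A_def f_def partitions_length_le_def\<close>)
    qed
  qed
  moreover have "partition_size (f l) = partition_size l + Suc k" if "l \<in> ?P (Suc k)" for l
  proof -
    have "partition_size (f l) = (\<Sum>i<Suc k. f l i)"
      by (rule partition_size_eq_sum) (simp add: f_def)
    also have "\<dots> = (\<Sum>i<Suc k. l i + 1)"
      by (rule sum.cong) (auto simp: f_def)
    also have "\<dots> = (\<Sum>i<Suc k. l i) + Suc k"
      by (simp only: sum.distrib) simp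
    also have "(\<Sum>i<Suc k. l i) = partition_size l"
      using that by (intro partition_size_eq_sum[symmetric]) (auto simp: partitions_length_le_def)
    finally show ?thesis .
  qed
  ultimately have "wgf partition_size A = X ^ Suc k * wgf partition_size (?P (Suc k))"
    by (rule wgf_bij_betw_shift[where w = partition_size and w' = partition_size])
  moreover have "finite_weights partition_size (?P k \<union> A)"
    using finite_weights_partitions partitions_length_le_subset
    unfolding split[symmetric] by (rule finite_weights_subset)
  ultimately have "(1 - X ^ Suc k) * wgf partition_size (?P (Suc k)) = wgf partition_size (?P k)"
    using wgf_Un_disjoint[of partition_size "?P k" A] split disjoint by (simp add: algebra_simps)
  also have "\<dots> = (1 - X ^ Suc k) * inverse (qpoch X X (Suc k))"
    using inverse_qpoch_Suc[of X X k] Suc.IH by simp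
  finally show ?case
    by (simp only: mult_left_cancel[OF one_minus_X_power_neq_0])
qed

text \<open>Up to degree n, both the infinite product and the set of all partitions may be replaced
  by their versions with n + 1 factors and at most n + 1 parts.\<close>

lemma wgf_partitions: "wgf partition_size partitions = inverse (qpoch_inf X X)"
proof -
  have "(qpoch_inf X X * wgf partition_size partitions) $ n = 1 $ n" for n
  proof -
    have *: "wgf partition_size partitions $ i = wgf partition_size (partitions_length_le (Suc n)) $ i"
      if "i \<le> n" for i
    proof -
      have "l \<in> partitions_length_le (Suc n)" if "l \<in> partitions" "partition_size l = i" for l
        using partition_length_le_size[OF that(1)] that(2) \<open>i \<le> n\<close> by (auto simp: partitions_length_le_def)
      hence "{l\<in>partitions. partition_size l = i} = {l\<in>partitions_length_le (Suc n). partition_size l = i}"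
        using partitions_length_le_subset by auto
      thus ?thesis by (simp add: wgf_nth)
    qed
    have "(qpoch_inf X X * wgf partition_size partitions) $ n
        = (qpoch X X (Suc n) * wgf partition_size partitions) $ n"
      by (rule fps_mult_cong_nth) (simp add: qpoch_inf_nth[of _ _ "Suc n"])
    also have "\<dots> = (wgf partition_size (partitions_length_le (Suc n)) * qpoch X X (Suc n)) $ n"
      unfolding mult.commute[of "qpoch X X (Suc n)"] using * by (rule fps_mult_cong_nth)
    also have "\<dots> = 1 $ n"
      using inverse_mult_eq_1[of "qpoch X X (Suc n)"]
      by (simp add: wgf_partitions_length_le qpoch_nth_0)
    finally show ?thesis .
  qed
  hence "qpoch_inf X X * wgf partition_size partitions = 1"
    by (rule fps_ext)
  thus ?thesis
    by (simp add: fps_inverse_unique)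
qed

section \<open>Sets without consecutive elements\<close>

definition sparse_sets :: "nat set set" where
  "sparse_sets = {S. finite S \<and> (\<forall>i\<in>S. Suc i \<notin> S)}"

definition sparse_sets_card :: "nat \<Rightarrow> nat set set" where
  "sparse_sets_card k = {S \<in> sparse_sets. card S = k}"

text \<open>An ascent at i accounts for one unit in each of the entries 0, ..., i, that is i + 1
  units.\<close>

definition set_weight :: "nat set \<Rightarrow> nat" where
  "set_weight S = (\<Sum>i\<in>S. Suc i)"

lemma finite_weights_sparse_sets: "finite_weights set_weight sparse_sets"
  unfolding finite_weights_def
proof
  fix n
  have "S \<subseteq> {..<n}" if "S \<in> sparse_sets" "set_weight S = n" for S
  proof
    fix i assume "i \<in> S"
    hence "Suc i \<le> set_weight S"
      unfolding set_weight_def using that by (intro member_le_sum) (auto simp: sparse_sets_def)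
    thus "i \<in> {..<n}" using that by simp
  qed
  hence "{S \<in> sparse_sets. set_weight S = n} \<subseteq> Pow {..<n}"
    by auto
  thus "finite {S \<in> sparse_sets. set_weight S = n}"
    by (rule finite_subset) simp
qed

lemma card_le_set_weight: "card S \<le> set_weight S"
  unfolding set_weight_def card_eq_sum by (intro sum_mono) simp

text \<open>If 0 is not in S, shifting S down by 1 loses weight k + 1. If 0 is in S then 1 is not,
  and removing 0 and shifting the rest down by 2 loses 1 + 2k. With W for the series this gives (1 -
  q^(k+1)) W(k+1) = q^(2k+1) W(k), and 2k + 1 + k^2 completes the square.\<close>

lemma wgf_sparse_sets_card: "wgf set_weight (sparse_sets_card k) = X ^ k\<^sup>2 * inverse (qpoch X X k)"
proof (induction k)
  case 0
  have "sparse_sets_card 0 = {{}}"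
    by (auto simp: sparse_sets_card_def sparse_sets_def)
  hence "wgf set_weight (sparse_sets_card 0) $ n = 1 $ n" for n
    by (auto simp: wgf_nth set_weight_def Collect_conv_if)
  thus ?case
    by (simp add: fps_eq_iff)
next
  case (Suc k)
  let ?Q = "sparse_sets_card"
  define A where "A = {S \<in> ?Q (Suc k). 0 \<notin> S}"
  define B where "B = {S \<in> ?Q (Suc k). 0 \<in> S}"
  have shift: "Suc ` {i. Suc i \<in> S} = S" if "0 \<notin> S" for S
    using that by (auto simp: image_iff) (metis not0_implies_Suc)
  have shift2: "insert 0 ((\<lambda>i. i + 2) ` {i. i + 2 \<in> S}) = S" if "0 \<in> S" "Suc 0 \<notin> S" for S
  proof -
    have "x \<in> (\<lambda>i. i + 2) ` {i. i + 2 \<in> S}" if "x \<in> S" "x \<noteq> 0" for x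
    proof -
      have "x \<noteq> Suc 0" using that \<open>Suc 0 \<notin> S\<close> by metis
      then obtain y where "x = y + 2"
        using \<open>x \<noteq> 0\<close> by (metis One_nat_def add_2_eq_Suc' not0_implies_Suc)
      thus ?thesis using that by auto
    qed
    thus ?thesis using that by auto
  qed
  have "bij_betw (\<lambda>S. Suc ` S) (?Q (Suc k)) A"
  proof (rule bij_betwI[where g = "\<lambda>S. {i. Suc i \<in> S}"])
    show "(\<lambda>S. Suc ` S) \<in> ?Q (Suc k) \<rightarrow> A"
      by (auto simp: A_def sparse_sets_card_def sparse_sets_def card_image)
    show "(\<lambda>S. {i. Suc i \<in> S}) \<in> A \<rightarrow> ?Q (Suc k)"
    proof
      fix S assume S: "S \<in> A"
      hence *: "Suc ` {i. Suc i \<in> S} = S" by (intro shift) (simp add: A_def)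
      hence "card {i. Suc i \<in> S} = card S" "finite {i. Suc i \<in> S} \<longleftrightarrow> finite S"
        by (metis card_image inj_Suc) (metis * finite_image_iff inj_Suc)
      thus "{i. Suc i \<in> S} \<in> ?Q (Suc k)"
        using S by (auto simp: A_def sparse_sets_card_def sparse_sets_def)
    qed
  qed (auto simp: A_def shift)
  moreover have "set_weight (Suc ` S) = set_weight S + Suc k" if "S \<in> ?Q (Suc k)" for S
  proof -
    have "set_weight (Suc ` S) = (\<Sum>i\<in>S. Suc i + 1)"
      by (simp add: set_weight_def sum.reindex)
    thus ?thesis
      using that unfolding sum.distrib by (simp add: set_weight_def sparse_sets_card_def)
  qed
  ultimately have wA: "wgf set_weight A = X ^ Suc k * wgf set_weight (?Q (Suc k))"
    by (rule wgf_bij_betw_shift[where w = set_weight and w' = set_weight])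

  have inj2: "inj_on (\<lambda>i::nat. i + 2) T" for T
    by (simp add: inj_on_def)
  have card2: "card ((\<lambda>i::nat. Suc (Suc i)) ` T) = card T" for T
    by (rule card_image) (simp add: inj_on_def)
  have "bij_betw (\<lambda>S. insert 0 ((\<lambda>i. i + 2) ` S)) (?Q k) B"
  proof (rule bij_betwI[where g = "\<lambda>S. {i. i + 2 \<in> S}"])
    show "(\<lambda>S. insert 0 ((\<lambda>i. i + 2) ` S)) \<in> ?Q k \<rightarrow> B"
      by (auto simp: B_def sparse_sets_card_def sparse_sets_def card2 card_insert_if)
    show "(\<lambda>S. {i. i + 2 \<in> S}) \<in> B \<rightarrow> ?Q k"
    proof
      fix S assume S: "S \<in> B"
      hence "insert 0 ((\<lambda>i. i + 2) ` {i. i + 2 \<in> S}) = S"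
        by (intro shift2) (auto simp: B_def sparse_sets_card_def sparse_sets_def)
      hence *: "(\<lambda>i. i + 2) ` {i. i + 2 \<in> S} = S - {0}" by auto
      have "finite S" "0 \<in> S" "card S = Suc k"
        using S by (auto simp: B_def sparse_sets_card_def sparse_sets_def)
      hence "finite {i. i + 2 \<in> S}" "card {i. i + 2 \<in> S} = k"
        using * finite_image_iff[OF inj2, of "{i. i + 2 \<in> S}"] card_image[OF inj2, of "{i. i + 2 \<in> S}"]
        by simp_all
      thus "{i. i + 2 \<in> S} \<in> ?Q k"
        using S by (auto simp: B_def sparse_sets_card_def sparse_sets_def)
    qed
    show "insert 0 ((\<lambda>i. i + 2) ` {i. i + 2 \<in> S}) = S" if "S \<in> B" for S
      using that by (intro shift2) (auto simp: B_def sparse_sets_card_def sparse_sets_def)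
  qed auto
  moreover have "set_weight (insert 0 ((\<lambda>i. i + 2) ` S)) = set_weight S + (2 * k + 1)"
    if "S \<in> ?Q k" for S
  proof -
    have "finite S" "card S = k" 
      using that by (auto simp: sparse_sets_card_def sparse_sets_def)
    have "set_weight (insert 0 ((\<lambda>i. i + 2) ` S)) = 1 + set_weight ((\<lambda>i. i + 2) ` S)"
      unfolding set_weight_def using \<open>finite S\<close> by (subst sum.insert) auto
    also have "set_weight ((\<lambda>i. i + 2) ` S) = (\<Sum>i\<in>S. Suc i + 2)"
      by (simp add: set_weight_def sum.reindex[OF inj2] del: add_2_eq_Suc')
    also have "\<dots> = set_weight S + 2 * k"
      unfolding sum.distrib using \<open>card S = k\<close> by (simp add: set_weight_def)
    finally show ?thesis by simp
  qed
  ultimately have wB: "wgf set_weight B = X ^ (2 * k + 1) * wgf set_weight (?Q k)"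
    by (rule wgf_bij_betw_shift[where w = set_weight and w' = set_weight])

  have "?Q (Suc k) = A \<union> B" "A \<inter> B = {}"
    by (auto simp: A_def B_def)
  moreover have "finite_weights set_weight (?Q (Suc k))"
    by (rule finite_weights_subset[OF finite_weights_sparse_sets]) (auto simp: sparse_sets_card_def)
  ultimately have "wgf set_weight (?Q (Suc k)) = wgf set_weight A + wgf set_weight B"
    using wgf_Un_disjoint[of set_weight A B] by simp
  hence "(1 - X ^ Suc k) * wgf set_weight (?Q (Suc k)) = X ^ (2 * k + 1) * wgf set_weight (?Q k)"
    unfolding wA wB by (simp add: algebra_simps)
  also have "\<dots> = X ^ (2 * k + 1) * (X ^ k\<^sup>2 * ((1 - X ^ Suc k) * inverse (qpoch X X (Suc k))))"
    using inverse_qpoch_Suc[of X X k] Suc.IH by simp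
  also have "\<dots> = (1 - X ^ Suc k) * (X ^ ((2 * k + 1) + k\<^sup>2) * inverse (qpoch X X (Suc k)))"
    by (simp only: power_add mult_ac)
  also have "(2 * k + 1) + k\<^sup>2 = (Suc k)\<^sup>2"
    by (simp add: power2_eq_square)
  finally show ?case
    by (simp only: mult_left_cancel[OF one_minus_X_power_neq_0])
qed

text \<open>Since the cardinality is at most the weight, only k up to n occur in degree n, matching
  the cutoff of \<open>fps_series\<close>.\<close>

lemma wgf_sparse_sets: "wgf set_weight sparse_sets = fps_series (\<lambda>k. X ^ k\<^sup>2 * inverse (qpoch X X k))"
proof (rule fps_ext)
  fix n
  define A where "A k = {S \<in> sparse_sets_card k. set_weight S = n}" for k
  have sub: "A k \<subseteq> {S \<in> sparse_sets. set_weight S = n}" for k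
    by (auto simp: A_def sparse_sets_card_def)
  have "card S \<le> n" if "set_weight S = n" for S
    using card_le_set_weight[of S] that by simp
  hence "{S \<in> sparse_sets. set_weight S = n} = (\<Union>k\<in>{..n}. A k)"
    by (auto simp: A_def sparse_sets_card_def)
  moreover have "card (\<Union>k\<in>{..n}. A k) = (\<Sum>k\<le>n. card (A k))"
  proof (rule card_UN_disjoint)
    show "\<forall>k\<in>{..n}. finite (A k)"
      using finite_subset[OF sub] finite_weightsD[OF finite_weights_sparse_sets] by blast
  qed (auto simp: A_def sparse_sets_card_def)
  ultimately show "wgf set_weight sparse_sets $ n = fps_series (\<lambda>k. X ^ k\<^sup>2 * inverse (qpoch X X k)) $ n"
    by (simp add: wgf_nth A_def fps_series_def flip: wgf_sparse_sets_card)
qed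

section \<open>Cylindric partitions of profile (2, 1)\<close>

text \<open>
  Interleaving the two partitions of a cylindric partition of profile \<open>(2, 1)\<close> turns all the defining
  inequalities into the single condition below: only neighbours are left uncompared.
\<close>
definition nearly_decreasing :: "(nat \<Rightarrow> nat) set" where
  "nearly_decreasing = {p. finite {i. p i \<noteq> 0} \<and> (\<forall>i j. i + 2 \<le> j \<longrightarrow> p j \<le> p i)}"

text \<open>The total added at index i when every s in S contributes 1 to the entries 0, ...,
  s.\<close>

definition tail_count :: "nat set \<Rightarrow> nat \<Rightarrow> nat" where
  "tail_count S i = card {s\<in>S. i \<le> s}"

text \<open>For sparse S the transpositions of s and s + 1 are disjoint, so this is an
  involution.\<close>

definition ascent_swap :: "nat set \<Rightarrow> nat \<Rightarrow> nat" where
  "ascent_swap S i = (if i \<in> S then Suc i else if i > 0 \<and> i - 1 \<in> S then i - 1 else i)"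

definition ascents :: "(nat \<Rightarrow> nat) \<Rightarrow> nat set" where
  "ascents p = {i. p i < p (Suc i)}"

lemma tail_count_Suc: "finite S \<Longrightarrow> tail_count S i = tail_count S (Suc i) + (if i \<in> S then 1 else 0)"
proof -
  assume "finite S"
  have "{s\<in>S. i \<le> s} = (if i \<in> S then insert i {s\<in>S. Suc i \<le> s} else {s\<in>S. Suc i \<le> s})"
    by (auto simp: Suc_le_eq le_less)
  thus ?thesis
    using \<open>finite S\<close> by (simp add: tail_count_def)
qed

lemma tail_count_antimono: "finite S \<Longrightarrow> antimono (tail_count S)"
  by (rule decseq_SucI) (metis le_add1 tail_count_Suc)

lemma tail_count_eq_0: "S \<subseteq> {..<N} \<Longrightarrow> i \<ge> N \<Longrightarrow> tail_count S i = 0"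
proof -
  assume "S \<subseteq> {..<N}" "i \<ge> N"
  hence "{s\<in>S. i \<le> s} = {}" by auto
  thus "tail_count S i = 0" by (simp only: tail_count_def card.empty)
qed

text \<open>Double counting of the pairs i <= s with s in S.\<close>

lemma sum_tail_count:
  assumes "S \<subseteq> {..<N}"
  shows "(\<Sum>i<N. tail_count S i) = set_weight S"
proof -
  have fin: "finite S"
    using assms finite_subset by blast
  have "(\<Sum>i<N. tail_count S i) = (\<Sum>i<N. \<Sum>s\<in>S. if i \<le> s then 1 else 0)"
    using fin by (simp add: tail_count_def sum.If_cases Int_def)
  also have "\<dots> = (\<Sum>s\<in>S. \<Sum>i<N. if i \<le> s then 1 else 0)"
    by (rule sum.swap)
  also have "\<dots> = (\<Sum>s\<in>S. Suc s)"
  proof (rule sum.cong)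
    fix s assume "s \<in> S"
    hence "{..<N} \<inter> {i. i \<le> s} = {..s}"
      using assms by auto
    thus "(\<Sum>i<N. if i \<le> s then 1 else 0) = Suc s"
      by (simp add: sum.If_cases)
  qed simp
  finally show ?thesis
    by (simp add: set_weight_def)
qed

text \<open>With \<open>ascent_swap_ge\<close>: indices move by at most one, so indices at distance
  at least 2 stay weakly ordered, and these are the ones that \<open>nearly_decreasing\<close>
  compares.\<close>

lemma ascent_swap_le: "ascent_swap S i \<le> Suc i"
  by (auto simp: ascent_swap_def)

lemma ascent_swap_ge: "i \<le> Suc (ascent_swap S i)"
  by (simp add: ascent_swap_def)

lemma ascent_swap_involution:
  assumes "S \<in> sparse_sets"
  shows "ascent_swap S (ascent_swap S i) = i"
proof (cases i)
  case 0
  thus ?thesis using assms by (auto simp: ascent_swap_def sparse_sets_def)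
next
  case (Suc j)
  thus ?thesis using assms by (cases j) (auto simp: ascent_swap_def sparse_sets_def)
qed

lemma partition_size_comp_ascent_swap:
  assumes S: "S \<in> sparse_sets"
  shows "partition_size (v \<circ> ascent_swap S) = partition_size v"
proof -
  have "bij_betw (ascent_swap S) {i. v (ascent_swap S i) \<noteq> 0} {i. v i \<noteq> 0}"
    by (rule bij_betwI[where g = "ascent_swap S"]) (auto simp: ascent_swap_involution[OF S])
  thus ?thesis
    unfolding partition_size_def o_def by (rule sum.reindex_bij_betw)
qed

section \<open>The bijection between pairs (partition, sparse set) and nearly decreasing
  sequences\<close>

definition unfold_pair :: "(nat \<Rightarrow> nat) \<times> nat set \<Rightarrow> nat \<Rightarrow> nat" where
  "unfold_pair = (\<lambda>(l, S). (\<lambda>i. l i + tail_count S i) \<circ> ascent_swap S)"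

text \<open>The ascents are recorded because sorting forgets them. On nearly decreasing sequences
  the subtraction is never truncated, by \<open>tail_count_le_ascent_swap\<close>.\<close>

definition fold_pair :: "(nat \<Rightarrow> nat) \<Rightarrow> (nat \<Rightarrow> nat) \<times> nat set" where
  "fold_pair p = (\<lambda>i. p (ascent_swap (ascents p) i) - tail_count (ascents p) i, ascents p)"

lemma bounded_supportE:
  assumes "l \<in> partitions" "S \<in> sparse_sets"
  obtains N where "\<forall>i\<ge>N. l i = 0" "S \<subseteq> {..<N}"
proof -
  obtain N where N: "\<forall>i\<ge>N. l i = 0"
    using assms(1) by (auto simp: partitions_def is_partition_def finite_support_iff simp del: neq0_conv)
  obtain M where M: "\<forall>s\<in>S. s < M"
    using assms(2) finite_nat_set_iff_bounded by (auto simp: sparse_sets_def)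
  show ?thesis
    by (rule that[of "max N M"]) (use N M in auto)
qed

lemma partition_size_unfold_pair:
  assumes l: "l \<in> partitions" and S: "S \<in> sparse_sets"
  shows "partition_size (unfold_pair (l, S)) = partition_size l + set_weight S"
proof -
  from l S obtain N where N: "\<forall>i\<ge>N. l i = 0" "S \<subseteq> {..<N}"
    by (rule bounded_supportE)
  have zero: "l i + tail_count S i = 0" if "i \<ge> N" for i
    using N that by (simp add: tail_count_eq_0)
  have "partition_size (unfold_pair (l, S)) = partition_size (\<lambda>i. l i + tail_count S i)"
    unfolding unfold_pair_def prod.case using S by (rule partition_size_comp_ascent_swap)
  also have "\<dots> = (\<Sum>i<N. l i + tail_count S i)"
    by (rule partition_size_eq_sum) (rule zero)
  also have "\<dots> = partition_size l + set_weight S"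
    using N by (simp add: sum.distrib sum_tail_count partition_size_eq_sum[of N l])
  finally show ?thesis .
qed

lemma unfold_pair_nearly_decreasing:
  assumes l: "l \<in> partitions" and S: "S \<in> sparse_sets"
  shows "unfold_pair (l, S) \<in> nearly_decreasing"
proof -
  define v where "v i = l i + tail_count S i" for i
  have p: "unfold_pair (l, S) i = v (ascent_swap S i)" for i
    by (simp add: unfold_pair_def v_def)
  have "finite S" using S by (simp add: sparse_sets_def)
  hence "antimono v"
    using l tail_count_antimono[of S]
    by (auto simp: v_def antimono_def partitions_def is_partition_def intro: add_mono)
  from l S obtain N where N: "\<forall>i\<ge>N. l i = 0" "S \<subseteq> {..<N}"
    by (rule bounded_supportE)
  have "v (ascent_swap S i) = 0" if "i \<ge> Suc N" for i
    using N ascent_swap_ge[of i S] that by (simp add: v_def tail_count_eq_0)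
  moreover have "v (ascent_swap S j) \<le> v (ascent_swap S i)" if "i + 2 \<le> j" for i j
    using \<open>antimono v\<close> ascent_swap_le[of S i] ascent_swap_ge[of j S] that by (intro antimonoD[of v]) auto
  ultimately show ?thesis
    unfolding nearly_decreasing_def mem_Collect_eq p finite_support_iff by blast
qed

text \<open>At i in S the tail count drops by one, so the sorted sequence descends strictly and the
  swap makes this an ascent. At i outside S the swap keeps the order of i and i + 1, so no ascent
  arises.\<close>

lemma ascents_unfold_pair:
  assumes l: "l \<in> partitions" and S: "S \<in> sparse_sets"
  shows "ascents (unfold_pair (l, S)) = S"
proof -
  define v where "v i = l i + tail_count S i" for i
  have p: "unfold_pair (l, S) i = v (ascent_swap S i)" for i
    by (simp add: unfold_pair_def v_def)
  have fin: "finite S" using S by (simp add: sparse_sets_def)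
  hence v: "antimono v"
    using l tail_count_antimono[of S]
    by (auto simp: v_def antimono_def partitions_def is_partition_def intro: add_mono)
  have "v (ascent_swap S i) < v (ascent_swap S (Suc i)) \<longleftrightarrow> i \<in> S" for i
  proof (cases "i \<in> S")
    case True
    hence "ascent_swap S i = Suc i" "ascent_swap S (Suc i) = i"
      using S by (auto simp: ascent_swap_def sparse_sets_def)
    moreover have "l (Suc i) \<le> l i"
      using l by (simp add: partitions_def is_partition_def antimono_def)
    ultimately show ?thesis
      using True tail_count_Suc[OF fin, of i] by (simp add: v_def)
  next
    case False
    hence "ascent_swap S i \<le> i" "Suc i \<le> ascent_swap S (Suc i)"
      by (auto simp: ascent_swap_def)
    hence "v (ascent_swap S (Suc i)) \<le> v (ascent_swap S i)"
      using v by (intro antimonoD[of v]) auto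
    thus ?thesis using False by simp
  qed
  thus ?thesis
    by (simp add: ascents_def p)
qed

lemma fold_unfold_pair:
  assumes "l \<in> partitions" and S: "S \<in> sparse_sets"
  shows "fold_pair (unfold_pair (l, S)) = (l, S)"
  unfolding fold_pair_def ascents_unfold_pair[OF assms]
  by (simp add: unfold_pair_def ascent_swap_involution[OF S])

context
  fixes p :: "nat \<Rightarrow> nat"
  assumes p: "p \<in> nearly_decreasing"
begin

text \<open>Two consecutive ascents would give p(i) < p(i + 2).\<close>

lemma ascents_sparse: "ascents p \<in> sparse_sets"
proof -
  obtain N where N: "\<forall>i\<ge>N. p i = 0"
    using p by (auto simp: nearly_decreasing_def finite_support_iff simp del: neq0_conv)
  have "i < N" if "i \<in> ascents p" for i
    by (rule ccontr) (use N that in \<open>simp add: ascents_def\<close>)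
  hence "ascents p \<subseteq> {..<N}" by auto
  hence "finite (ascents p)"
    using finite_subset by blast
  moreover have "p (Suc (Suc i)) \<le> p i" for i
    using p by (simp add: nearly_decreasing_def)
  hence "\<not> (p i < p (Suc i) \<and> p (Suc i) < p (Suc (Suc i)))" for i
    by (metis less_trans not_le)
  ultimately show ?thesis
    by (auto simp: sparse_sets_def ascents_def)
qed

text \<open>The strict drop at each ascent leaves room for subtracting the tail counts without
  losing monotonicity.\<close>

lemma ascent_swap_decreasing:
  "p (ascent_swap (ascents p) (Suc i)) + (if i \<in> ascents p then 1 else 0) \<le> p (ascent_swap (ascents p) i)"
proof -
  let ?s = "ascent_swap (ascents p)"
  have far: "p j \<le> p i" if "i + 2 \<le> j" for i j
    using p that by (simp add: nearly_decreasing_def)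
  show ?thesis
  proof (cases "i \<in> ascents p")
    case True
    hence "?s i = Suc i" "?s (Suc i) = i"
      using ascents_sparse by (auto simp: ascent_swap_def sparse_sets_def)
    thus ?thesis
      using True by (simp add: ascents_def)
  next
    case False
    show ?thesis
    proof (cases "?s (Suc i) = Suc i \<and> ?s i = i")
      case True
      thus ?thesis
        using False by (simp add: ascents_def)
    next
      case *: False
      \<comment> \<open>As i and i + 1 are not exchanged with each other, any move takes them
        further apart.\<close>
      hence "?s i + 2 \<le> ?s (Suc i)"
        using False by (auto simp: ascent_swap_def split: if_splits)
      thus ?thesis
        using False far by simp
    qed
  qed
qed

text \<open>Downward induction from an index beyond all ascents, where the tail count is 0: passing
  an ascent raises the tail count by one and the sorted sequence by at least one.\<close>

lemma tail_count_le_ascent_swap: "tail_count (ascents p) i \<le> p (ascent_swap (ascents p) i)"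
proof -
  have fin: "finite (ascents p)"
    using ascents_sparse by (simp add: sparse_sets_def)
  then obtain N where "\<forall>s\<in>ascents p. s < N"
    using finite_nat_set_iff_bounded by blast
  hence zero: "tail_count (ascents p) (max i N) = 0"
    by (intro tail_count_eq_0[of _ N]) auto
  have "i \<le> max i N"
    by simp
  thus ?thesis
  proof (induction rule: inc_induct)
    case base
    show ?case by (simp add: zero)
  next
    case (step j)
    thus ?case
      using ascent_swap_decreasing[of j] tail_count_Suc[OF fin, of j] by linarith
  qed
qed

lemma fold_pair_mem: "fold_pair p \<in> partitions \<times> sparse_sets"
proof -
  define l where "l i = p (ascent_swap (ascents p) i) - tail_count (ascents p) i" for i
  have fin: "finite (ascents p)"
    using ascents_sparse by (simp add: sparse_sets_def)
  have "l (Suc i) \<le> l i" for i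
    using ascent_swap_decreasing[of i] tail_count_Suc[OF fin, of i] by (simp add: l_def)
  hence "antimono l"
    by (rule decseq_SucI)
  moreover obtain N where N: "\<forall>i\<ge>N. p i = 0"
    using p by (auto simp: nearly_decreasing_def finite_support_iff simp del: neq0_conv)
  have "l i = 0" if "i \<ge> Suc N" for i
    using N ascent_swap_ge[of i "ascents p"] that by (simp add: l_def)
  hence "finite {i. l i \<noteq> 0}"
    unfolding finite_support_iff by blast
  ultimately have "l \<in> partitions"
    by (simp add: partitions_def is_partition_def)
  thus ?thesis
    using ascents_sparse by (simp add: fold_pair_def flip: l_def)
qed

lemma unfold_fold_pair: "unfold_pair (fold_pair p) = p"
  using tail_count_le_ascent_swap
  by (simp add: unfold_pair_def fold_pair_def fun_eq_iff ascent_swap_involution[OF ascents_sparse])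

end

lemma bij_betw_unfold_pair: "bij_betw unfold_pair (partitions \<times> sparse_sets) nearly_decreasing"
  by (rule bij_betwI[where g = fold_pair])
     (auto simp: unfold_pair_nearly_decreasing fold_unfold_pair fold_pair_mem[THEN subsetD[rotated]]
        unfold_fold_pair intro: fold_pair_mem)

section \<open>Interleaving the two component partitions\<close>

definition deinterleave :: "(nat \<Rightarrow> nat) \<Rightarrow> (nat \<Rightarrow> nat) list" where
  "deinterleave p = [\<lambda>j. p (2 * j), \<lambda>j. p (2 * j + 1)]"

definition interleave :: "(nat \<Rightarrow> nat) list \<Rightarrow> nat \<Rightarrow> nat" where
  "interleave L i = (L ! (i mod 2)) (i div 2)"

text \<open>In interleaved positions the two mixed inequalities compare 2j with 2j + 3 and 2j + 1
  with 2j + 4, both at distance 3. Monotonicity of \<open>a\<close> and \<open>b\<close> supplies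
  distance 2, and together these generate every distance of at least 2.\<close>

lemma cylindric_partitions_2_1:
  "[a, b] \<in> cylindric_partitions [2, 1] \<longleftrightarrow>
     is_partition a \<and> is_partition b \<and> (\<forall>j. b (Suc j) \<le> a j) \<and> (\<forall>j. a (j + 2) \<le> b j)"
  by (auto simp: cylindric_partitions_def)

lemma cylindric_partitions_2_1E:
  assumes "L \<in> cylindric_partitions [2, 1]"
  obtains a b where "L = [a, b]"
proof -
  have "length L = 2" using assms by (simp add: cylindric_partitions_def)
  thus ?thesis using that by (auto simp: length_Suc_conv numeral_2_eq_2)
qed

lemma deinterleave_mem:
  assumes "p \<in> nearly_decreasing"
  shows "deinterleave p \<in> cylindric_partitions [2, 1]"
proof -
  have dec: "p j \<le> p i" if "i + 2 \<le> j" for i j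
    using assms that by (simp add: nearly_decreasing_def)
  obtain N where N: "\<forall>i\<ge>N. p i = 0"
    using assms by (auto simp: nearly_decreasing_def finite_support_iff simp del: neq0_conv)
  have part: "is_partition (\<lambda>j. p (2 * j + r))" for r
    unfolding is_partition_def finite_support_iff
  proof
    show "antimono (\<lambda>j. p (2 * j + r))"
      by (rule decseq_SucI) (rule dec, simp)
    show "\<exists>N. \<forall>j\<ge>N. p (2 * j + r) = 0"
      using N by (intro exI[of _ N]) simp
  qed
  from part[of 0] part[of 1] show ?thesis
    unfolding deinterleave_def cylindric_partitions_2_1 by (auto intro!: dec)
qed

lemma interleave_mem:
  assumes "[a, b] \<in> cylindric_partitions [2, 1]"
  shows "interleave [a, b] \<in> nearly_decreasing"
proof -
  have ab: "antimono a" "antimono b" "finite {j. a j \<noteq> 0}" "finite {j. b j \<noteq> 0}"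
      "\<And>j. b (Suc j) \<le> a j" "\<And>j. a (j + 2) \<le> b j"
    using assms unfolding cylindric_partitions_2_1 is_partition_def by blast+
  let ?p = "interleave [a, b]"
  have even: "?p (2 * k) = a k" and odd: "?p (2 * k + 1) = b k" for k
    by (simp_all add: interleave_def)
  obtain N M where NM: "\<forall>i\<ge>N. a i = 0" "\<forall>i\<ge>M. b i = 0"
    using ab(3,4) unfolding finite_support_iff by blast
  have "?p i = 0" if "i \<ge> 2 * max N M" for i
  proof (cases "even i")
    case True
    then obtain k where "i = 2 * k" ..
    thus ?thesis using NM that even by simp
  next
    case False
    then obtain k where "i = 2 * k + 1" by (rule oddE)
    thus ?thesis using NM that odd by simp
  qed
  \<comment> \<open>Positions of equal parity lie in one partition. For mixed parity the distance is
    at least 3, so monotonicity first leads to the entry at distance exactly 3.\<close>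
  moreover have "?p j \<le> ?p i" if ij: "i + 2 \<le> j" for i j
  proof (cases "even i"; cases "even j")
    assume "even i" "even j"
    then obtain m n where *: "i = 2 * m" "j = 2 * n" by (metis evenE)
    thus ?thesis using ij antimonoD[OF ab(1), of m n] by (simp only: even)
  next
    assume "even i" "odd j"
    then obtain m n where *: "i = 2 * m" "j = 2 * n + 1" by (metis evenE oddE)
    hence "b n \<le> b (Suc m)"
      using ij by (intro antimonoD[OF ab(2)]) simp
    thus ?thesis using * order_trans[OF _ ab(5)] by (simp only: even odd)
  next
    assume "odd i" "even j"
    then obtain m n where *: "i = 2 * m + 1" "j = 2 * n" by (metis evenE oddE)
    hence "a n \<le> a (m + 2)"
      using ij by (intro antimonoD[OF ab(1)]) simp
    thus ?thesis using * order_trans[OF _ ab(6)] by (simp only: even odd)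
  next
    assume "odd i" "odd j"
    then obtain m n where *: "i = 2 * m + 1" "j = 2 * n + 1" by (metis oddE)
    thus ?thesis using ij antimonoD[OF ab(2), of m n] by (simp only: odd)
  qed
  ultimately show ?thesis
    unfolding nearly_decreasing_def mem_Collect_eq finite_support_iff by blast
qed

lemma bij_betw_deinterleave:
  "bij_betw deinterleave nearly_decreasing (cylindric_partitions [2, 1])"
proof (rule bij_betwI[where g = interleave])
  show "deinterleave \<in> nearly_decreasing \<rightarrow> cylindric_partitions [2, 1]"
    by (intro Pi_I deinterleave_mem)
  show "interleave \<in> cylindric_partitions [2, 1] \<rightarrow> nearly_decreasing"
    by (metis Pi_I cylindric_partitions_2_1E interleave_mem)
  show "interleave (deinterleave p) = p" for p
  proof
    fix i
    show "interleave (deinterleave p) i = p i"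
    proof (cases "even i")
      case False
      then obtain k where "i = 2 * k + 1" by (rule oddE)
      thus ?thesis by (simp add: interleave_def deinterleave_def)
    qed (auto simp: interleave_def deinterleave_def)
  qed
  show "deinterleave (interleave L) = L" if "L \<in> cylindric_partitions [2, 1]" for L
    using that by (rule cylindric_partitions_2_1E) (auto simp: interleave_def deinterleave_def)
qed

lemma cylindric_size_deinterleave:
  assumes "p \<in> nearly_decreasing"
  shows "cylindric_size (deinterleave p) = partition_size p"
proof -
  obtain N where N: "\<forall>i\<ge>N. p i = 0"
    using assms by (auto simp: nearly_decreasing_def finite_support_iff simp del: neq0_conv)
  have "partition_size (\<lambda>j. p (2 * j + r)) = (\<Sum>j<N. p (2 * j + r))" for r
    using N by (intro partition_size_eq_sum) simp
  from this[of 0] this[of 1] have "cylindric_size (deinterleave p) = (\<Sum>j<N. p (2 * j) + p (2 * j + 1))"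
    by (simp add: cylindric_size_def deinterleave_def sum.distrib)
  also have "\<dots> = (\<Sum>i<2 * N. p i)"
    by (induction N) simp_all
  also have "\<dots> = partition_size p"
    using N by (intro partition_size_eq_sum[symmetric]) simp
  finally show ?thesis .
qed

section \<open>Assembly of the generating function\<close>

lemma qseries_sums:
  "fps_series (\<lambda>n. X ^ n\<^sup>2 * inverse (qpoch (X ^ 4) (X ^ 4) n)) = (\<Sum>n. X ^ n\<^sup>2 / qpoch (X ^ 4) (X ^ 4) n)"
proof -
  have "(\<lambda>n. X ^ n\<^sup>2 * inverse (qpoch (X ^ 4) (X ^ 4) n)) sums
      fps_series (\<lambda>n. X ^ n\<^sup>2 * inverse (qpoch (X ^ 4) (X ^ 4) n))"
    by (rule sums_fps_series) (auto intro!: fps_X_power_mult_small simp: power2_eq_square)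
  thus ?thesis
    by (simp add: sums_unique fps_divide_unit qpoch_nth_0)
qed

theorem theorem4p1:
  fixes q :: "rat fps"
  defines "q \<equiv> fps_X"
  shows "((\<lambda>L. q ^ cylindric_size L) has_sum
           ((\<Sum>n. q ^ (n\<^sup>2) / qpoch (q ^ 4) (q ^ 4) n) *
            (qpoch_inf (- (q\<^sup>2)) (q\<^sup>2) / qpoch_inf q q)))
         (cylindric_partitions [2, 1])"
proof -
  let ?w = "\<lambda>(l, S). partition_size l + set_weight S"
  have bij: "bij_betw (deinterleave \<circ> unfold_pair) (partitions \<times> sparse_sets) (cylindric_partitions [2, 1])"
    using bij_betw_unfold_pair bij_betw_deinterleave by (rule bij_betw_trans)
  \<comment> \<open>The bijection preserves weight; the summand 0 is the shift \<open>k\<close> of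
    \<open>wgf_bij_betw_shift\<close>.\<close>
  have size: "cylindric_size ((deinterleave \<circ> unfold_pair) x) = ?w x + 0"
    if "x \<in> partitions \<times> sparse_sets" for x
    using that
    by (auto simp: cylindric_size_deinterleave unfold_pair_nearly_decreasing partition_size_unfold_pair)
  have fin: "finite_weights cylindric_size (cylindric_partitions [2, 1])"
    using bij size finite_weights_Times[OF finite_weights_partitions finite_weights_sparse_sets]
    by (rule finite_weights_bij_betw)
  have "wgf cylindric_size (cylindric_partitions [2, 1]) = X ^ 0 * wgf ?w (partitions \<times> sparse_sets)"
    using bij size by (rule wgf_bij_betw_shift)
  also have "\<dots> = wgf partition_size partitions * wgf set_weight sparse_sets"
    by (simp add: wgf_Times finite_weights_partitions finite_weights_sparse_sets)
  also have "\<dots> = (\<Sum>n. X ^ n\<^sup>2 / qpoch (X ^ 4) (X ^ 4) n) * (qpoch_inf (- (X\<^sup>2)) (X\<^sup>2) * inverse (qpoch_inf X X))"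
    unfolding wgf_partitions wgf_sparse_sets rogers_series_mult_qpoch_inf[symmetric] qseries_sums
    by (simp only: mult_ac)
  \<comment> \<open>The denominator is a unit, since its constant term is 1.\<close>
  also have "qpoch_inf (- (X\<^sup>2)) (X\<^sup>2) * inverse (qpoch_inf X X) = qpoch_inf (- (X\<^sup>2)) (X\<^sup>2) / qpoch_inf X X"
    by (rule fps_divide_unit[symmetric]) (simp add: qpoch_inf_nth[of X 0 1] qpoch_nth_0)
  finally show ?thesis
    unfolding q_def using has_sum_wgf[OF fin] by simp
qed

end
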